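(* For every $M>\frac23$, the Biot stress-stretch relation $U\mapsto T_{\rm Biot}(U)$, $T_{\rm Biot}:\mathrm{Sym}^{++}(3)\to\mathrm{Sym}(3)$, for the Neo-Hooke-Ciarlet-Geymonat energy with parameter $M$ is not a diffeomorphism.
   Context: $\mathrm{Sym}(3)$ is the space of real symmetric $3\times3$ matrices and $\mathrm{Sym}^{++}(3)$ its open subset of positive definite matrices. For $M>\frac23$, the Biot stress tensor of the (one-parameter) Neo-Hooke-Ciarlet-Geymonat energy $\frac12\|U\|^2-\log\det U+\left(\frac M4-\frac16\right)\left((\det U)^2-2\log\det U-1\right)$ is, for $U\in\mathrm{Sym}^{++}(3)$, $$T_{\rm Biot}(U)=U+\Big[\Big(\tfrac M2-\tfrac13\Big)\Big(\det U-\tfrac1{\det U}\Big)-\tfrac1{\det U}\Big](\det U)\,U^{-1}.$$ *)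

theory Defs
  imports "HOL-Analysis.Analysis"
begin

definition Sym3 :: "(real^3^3) set" where
  "Sym3 = {A. transpose A = A}"

definition SymPP3 :: "(real^3^3) set" where
  "SymPP3 = {A \<in> Sym3. \<forall>x. x \<noteq> 0 \<longrightarrow> x \<bullet> (A *v x) > 0}"

definition T_Biot :: "real \<Rightarrow> real^3^3 \<Rightarrow> real^3^3" where
  "T_Biot M U = U + (((M / 2 - 1 / 3) * (det U - 1 / det U) - 1 / det U) * det U) *\<^sub>R matrix_inv U"

(* Continuously differentiable maps. The set S is meant to be relatively open in a linear
   subspace V, such as SymPP3 in Sym3. Differentiating within S then determines the derivative
   on V only. Its values off V are arbitrary, so asking for some continuous choice of f' is the
   same as asking for a continuous derivative V -> 'b: extend the latter by composing with a
   continuous linear projection onto V. *)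
definition C1_on :: "('a::euclidean_space \<Rightarrow> 'b::euclidean_space) \<Rightarrow> 'a set \<Rightarrow> bool" where
  "C1_on f S \<longleftrightarrow>
    (\<exists>f' :: 'a \<Rightarrow> 'a \<Rightarrow>\<^sub>L 'b.
       (\<forall>x\<in>S. (f has_derivative blinfun_apply (f' x)) (at x within S)) \<and> continuous_on S f')"

(* C^1 is the weakest class in use. A smooth diffeomorphism is also a C^1 diffeomorphism, so
   failing to be a C^1 diffeomorphism rules out every higher class. *)
definition diffeomorphism ::
  "'a::euclidean_space set \<Rightarrow> 'b::euclidean_space set \<Rightarrow> ('a \<Rightarrow> 'b) \<Rightarrow> bool" where
  "diffeomorphism S T f \<longleftrightarrow> bij_betw f S T \<and> C1_on f S \<and> C1_on (the_inv_into S f) T"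

(* T_Biot is a map SymPP3 -> Sym3, so that a failure to be a diffeomorphism between
   these two sets is never due to a wrong codomain. *)
lemma T_Biot_in_Sym3:
  assumes "U \<in> SymPP3"
  shows "T_Biot M U \<in> Sym3"
proof -
  have sym: "transpose U = U" and pos: "\<And>x. x \<noteq> 0 \<Longrightarrow> x \<bullet> (U *v x) > 0"
    using assms by (auto simp: SymPP3_def Sym3_def)
  have "invertible U"
    unfolding invertible_left_inverse matrix_left_invertible_ker
    using pos by (metis inner_zero_right less_irrefl)
  then have inv: "U ** matrix_inv U = mat 1" "matrix_inv U ** U = mat 1"
    unfolding invertible_def matrix_inv_def by (metis (mono_tags, lifting) someI_ex)+
  have "transpose (matrix_inv U) ** U = mat 1"
    by (metis inv(1) matrix_transpose_mul sym transpose_mat)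
  then have "transpose (matrix_inv U) = matrix_inv U"
    by (metis inv(1) matrix_mul_assoc matrix_mul_lid matrix_mul_rid)
  moreover have "transpose (A + B) = transpose A + transpose B" for A B :: "real^3^3"
    by (simp add: transpose_def vec_eq_iff)
  ultimately show ?thesis
    by (simp add: Sym3_def T_Biot_def transpose_scalar sym del: transpose_matrix_vector)
qed

end

(* The map is not injective.  Writing d = det U and g = (M/2 - 1/3) (d^2 - 1) - 1, the map sends U
   to U + g U^{-1}, so it sends diag(x, y, z) to the diagonal matrix with entries x + g/x, y + g/y,
   z + g/z.  If xy = g, the first two entries agree, and exchanging x and y, which does not change
   d, does not change the image.  Since M > 2/3, there is d > 0 with g = 2, and x = 1, y = 2,
   z = d/2 are then as wanted. *)
theory Submission
  imports Defs
begin

definition diag_mat :: "'a::zero^'n \<Rightarrow> 'a^'n^'n" where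
  "diag_mat v = (\<chi> i j. if i = j then v $ i else 0)"

lemma diag_mat_nth [simp]: "diag_mat v $ i $ j = (if i = j then v $ i else 0)"
  by (simp add: diag_mat_def)

lemma det_diag_mat: "det (diag_mat v) = (\<Prod>i\<in>UNIV. v $ i)"
  by (simp add: det_diagonal)

lemma diag_mat_mult:
  fixes v w :: "'a::semiring_1^'n"
  shows "diag_mat v ** diag_mat w = diag_mat (\<chi> i. v $ i * w $ i)"
  by (simp add: matrix_matrix_mult_def vec_eq_iff if_distrib[of "\<lambda>t. t * _"] cong: if_cong)

lemma diag_mat_vector_mult:
  fixes v x :: "'a::semiring_1^'n"
  shows "diag_mat v *v x = (\<chi> i. v $ i * x $ i)"
  by (simp add: matrix_vector_mult_def vec_eq_iff if_distrib[of "\<lambda>t. t * _"] cong: if_cong)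

text \<open>\<open>matrix_inv\<close> is a choice among two-sided inverses. Since \<open>B\<close>
  witnesses existence, the chosen matrix is a right inverse of \<open>A\<close>, and multiplying by
  the left inverse \<open>B\<close> identifies it.\<close>

lemma matrix_inv_unique:
  fixes A :: "'a::semiring_1^'n^'m"
  assumes "A ** B = mat 1" and "B ** A = mat 1"
  shows "matrix_inv A = B"
proof -
  have "\<exists>C. A ** C = mat 1 \<and> C ** A = mat 1"
    using assms by blast
  then have "A ** matrix_inv A = mat 1"
    unfolding matrix_inv_def by (rule someI2_ex) blast
  then show ?thesis
    by (metis assms(2) matrix_mul_assoc matrix_mul_lid matrix_mul_rid)
qed

lemma matrix_inv_diag_mat:
  fixes v :: "'a::field^'n"
  assumes "\<And>i. v $ i \<noteq> 0"
  shows "matrix_inv (diag_mat v) = diag_mat (\<chi> i. inverse (v $ i))"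
  by (rule matrix_inv_unique) (simp_all add: diag_mat_mult assms mat_def vec_eq_iff)

text \<open>The quadratic form is a sum of squares weighted by the entries of \<open>v\<close>, so a
  single nonzero coordinate makes it positive.\<close>

lemma diag_mat_in_SymPP3:
  assumes "\<And>i. v $ i > 0"
  shows "diag_mat v \<in> SymPP3"
proof -
  have "x \<bullet> (diag_mat v *v x) > 0" if "x \<noteq> 0" for x
  proof -
    have eq: "x $ i * (v $ i * x $ i) = v $ i * (x $ i)\<^sup>2" for i
      by (simp add: power2_eq_square)
    have nonneg: "v $ i * (x $ i)\<^sup>2 \<ge> 0" for i
      using less_imp_le[OF assms] by simp
    obtain k where "x $ k \<noteq> 0"
      using \<open>x \<noteq> 0\<close> by (auto simp: vec_eq_iff)
    with assms[of k] have "v $ k * (x $ k)\<^sup>2 > 0"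
      by simp
    then have "(\<Sum>i\<in>UNIV. v $ i * (x $ i)\<^sup>2) > 0"
      by (intro sum_pos2[of _ k] nonneg) simp_all
    then show ?thesis
      by (simp add: diag_mat_vector_mult inner_vec_def eq)
  qed
  then show ?thesis
    by (simp add: SymPP3_def Sym3_def transpose_def vec_eq_iff)
qed

text \<open>The factor \<open>det U\<close> clears both quotients by \<open>det U\<close> in the
  coefficient of the inverse; the entries of \<open>v\<close> interact only through their product
  \<open>d\<close>.\<close>

lemma T_Biot_diag_mat:
  fixes v :: "real^3"
  assumes "\<And>i. v $ i > 0" and d: "(\<Prod>i\<in>UNIV. v $ i) = d"
  shows "T_Biot M (diag_mat v) =
    diag_mat (\<chi> i. v $ i + ((M / 2 - 1 / 3) * (d\<^sup>2 - 1) - 1) / v $ i)"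
proof -
  have "d \<noteq> 0" and nz: "\<And>i. v $ i \<noteq> 0"
    using assms(1) by (auto simp: d[symmetric] less_imp_neq[symmetric])
  have "((M / 2 - 1 / 3) * (d - 1 / d) - 1 / d) * d = (M / 2 - 1 / 3) * (d\<^sup>2 - 1) - 1"
    using \<open>d \<noteq> 0\<close> by (simp add: field_simps power2_eq_square)
  then show ?thesis
    by (simp add: T_Biot_def det_diag_mat d matrix_inv_diag_mat nz vec_eq_iff inverse_eq_divide)
qed

theorem proposition4p1:
  fixes M :: real
  assumes "M > 2 / 3"
  shows "\<not> diffeomorphism SymPP3 Sym3 (T_Biot M)"
proof
  assume "diffeomorphism SymPP3 Sym3 (T_Biot M)"
  then have inj: "inj_on (T_Biot M) SymPP3"
    by (simp add: diffeomorphism_def bij_betw_def)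
  define c where "c = M / 2 - 1 / 3"
  have "c > 0"
    using assms by (simp add: c_def)
  \<comment> \<open>The positive solution of \<open>c * (d\<^sup>2 - 1) = 3\<close>, available
    because \<open>c > 0\<close>.\<close>
  define d where "d = sqrt ((c + 3) / c)"
  have "d > 0" and g: "c * (d\<^sup>2 - 1) - 1 = 2"
    using \<open>c > 0\<close> by (simp_all add: d_def field_simps)
  define v w :: "real^3" where "v = vector [1, 2, d / 2]" and "w = vector [2, 1, d / 2]"
  have pos: "v $ i > 0" "w $ i > 0" for i
    using \<open>d > 0\<close> exhaust_3[of i] by (auto simp: v_def w_def)
  have det: "(\<Prod>i\<in>UNIV. v $ i) = d" "(\<Prod>i\<in>UNIV. w $ i) = d"
    unfolding UNIV_3 by (simp_all add: v_def w_def)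
  \<comment> \<open>With coefficient 2, the first two entries are 1 + 2/1 and 2 + 2/2, both equal to
    3; the third entries coincide.\<close>
  have "T_Biot M (diag_mat v) = T_Biot M (diag_mat w)"
    unfolding T_Biot_diag_mat[OF pos(1) det(1)] T_Biot_diag_mat[OF pos(2) det(2)]
      c_def[symmetric] g
    by (rule arg_cong[of _ _ diag_mat]) (simp add: vec_eq_iff forall_3 v_def w_def)
  then have "diag_mat v = diag_mat w"
    using inj diag_mat_in_SymPP3 pos by (meson inj_onD)
  then have "diag_mat v $ 1 $ 1 = diag_mat w $ 1 $ 1"
    by simp
  then show False
    by (simp add: v_def w_def)
qed

end
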